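(* There exists an increasing infinite sequence $T=\{t_i\}_{i\in\mathbb{N}}$ of positive integers which is $6$-GP-free and such that for every $\varepsilon>0$ there exists a constant $C_\varepsilon>0$ for which $$t_{i+1}-t_i< C_\varepsilon \exp\Big(\Big(\tfrac{5}{6}\log 2+\varepsilon\Big)\frac{\log t_i}{\log\log t_i}\Big)$$ holds for all $i\in\mathbb{N}$ (where, if $t_i=1$, the quotient $\frac{\log t_i}{\log\log t_i}$ is interpreted as $0$).
   Context: $\mathbb{N}$ denotes the positive integers and $\log$ is the natural logarithm. For an integer $k\ge 3$ and a positive rational number $r$, a geometric progression of length $k$ (a $k$-GP) with common ratio $r$ is a sequence $(a_0,\dots,a_{k-1})$ of nonzero real numbers with $a_i=r a_{i-1}$ for $i=1,\dots,k-1$. It is trivial if $r=1$. A sequence of positive integers is $k$-GP-free if it contains no nontrivial $k$-GP, i.e. there is no nontrivial $k$-GP all of whose terms occur in the sequence. The same sequence $T$ must work for all $\varepsilon>0$. *)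

theory Defs
  imports Complex_Main
begin

(* Only the values a 0, ..., a (k - 1) of the function a are relevant. *)
definition geometric_progression :: "nat \<Rightarrow> real \<Rightarrow> (nat \<Rightarrow> real) \<Rightarrow> bool" where
  "geometric_progression k r a \<longleftrightarrow>
     k \<ge> 3 \<and> r \<in> \<rat> \<and> r > 0 \<and>
     (\<forall>i<k. a i \<noteq> 0) \<and>
     (\<forall>i\<in>{1..<k}. a i = r * a (i - 1))"

(* S is the set of terms of a sequence of positive integers. *)
definition GP_free :: "nat \<Rightarrow> nat set \<Rightarrow> bool" where
  "GP_free k S \<longleftrightarrow>
     \<not> (\<exists>r a. geometric_progression k r a \<and> r \<noteq> 1 \<and> (\<forall>i<k. a i \<in> real ` S))"

end

theory Submission
  imports Defs "HOL-Computational_Algebra.Primes" "HOL-Library.Infinite_Set"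
    "HOL-Analysis.Harmonic_Numbers" "HOL-Analysis.Summation_Tests" "HOL-Real_Asymp.Real_Asymp"
begin

text \<open>
  Among the terms of a nontrivial 6-GP with ratio \<open>b / a\<close> in lowest terms are the two integers
  \<open>c a\<^sup>3 b\<^sup>2\<close> and \<open>c a\<^sup>2 b\<^sup>3\<close>. Call such a pair linked and flip a fair coin for every linked pair
  to decide which member is deleted; whatever survives is 6-GP-free. Let
  \<open>h = exp (c log t / log log t)\<close>. At least \<open>h / 8\<close> of the integers in \<open>(t, t + h]\<close> are not
  divisible by \<open>d\<^sup>2\<close> for any \<open>2 \<le> d \<le> h / 8\<close>. Such an integer has at most about
  \<open>log t / (2 log h)\<close> prime squares in it, and hence is linked to at most
  \<open>3 ^ (log t / (2 log h)) = (log t) ^ (log 3 / (2 c) + o(1))\<close> integers, which is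
  \<open>o(log h)\<close> as soon as \<open>c > log 3 / 2\<close>. No two of them are linked to each other, since linked
  integers of this kind differ by more than \<open>h\<close>; their survivals are thus independent, and
  \<open>(t, t + h]\<close> has no survivor with probability at most \<open>t ^ (-2)\<close>. Since
  \<open>log 3 / 2 < 5/6 log 2\<close>, there is room for \<open>c = 5/9\<close>, and the coins can be fixed one by one
  by the method of conditional expectations.
\<close>

section \<open>Conditional expectations for independent coin flips\<close>

text \<open>
  The probability that \<open>v\<close> survives, i.e. that \<open>\<xi>\<close> agrees with \<open>val v\<close> on \<open>S v\<close>, given the coins
  \<open>\<xi> i\<close> with \<open>i < k\<close>.
\<close>
definition survival :: "('a \<Rightarrow> nat set) \<Rightarrow> ('a \<Rightarrow> nat \<Rightarrow> bool) \<Rightarrow> nat \<Rightarrow> (nat \<Rightarrow> bool) \<Rightarrow> 'a \<Rightarrow> real" where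
  "survival S val k \<xi> v =
     (if \<forall>i\<in>S v. i < k \<longrightarrow> \<xi> i = val v i then (1/2) ^ card {i\<in>S v. k \<le> i} else 0)"

lemma survival_le_1: "survival S val k \<xi> v \<le> 1"
  by (auto simp: survival_def power_le_one)

lemma survival_upd_notin:
  assumes "k \<notin> S v"
  shows "survival S val (Suc k) (\<xi>(k := b)) v = survival S val k \<xi> v"
proof -
  have "{i \<in> S v. Suc k \<le> i} = {i \<in> S v. k \<le> i}"
    using assms by (metis Suc_leD le_antisym not_less_eq_eq)
  moreover have "(\<forall>i\<in>S v. i < Suc k \<longrightarrow> (\<xi>(k := b)) i = val v i) \<longleftrightarrow> (\<forall>i\<in>S v. i < k \<longrightarrow> \<xi> i = val v i)"
    using assms by (auto simp: less_Suc_eq)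
  ultimately show ?thesis by (simp only: survival_def)
qed

lemma survival_upd_in:
  assumes "k \<in> S v" "finite (S v)"
  shows "survival S val (Suc k) (\<xi>(k := b)) v = (if b = val v k then 2 * survival S val k \<xi> v else 0)"
proof -
  have "{i \<in> S v. k \<le> i} = insert k {i \<in> S v. Suc k \<le> i}"
    using assms by auto
  moreover have "finite {i \<in> S v. Suc k \<le> i}" using assms by auto
  ultimately have c: "card {i \<in> S v. k \<le> i} = Suc (card {i \<in> S v. Suc k \<le> i})"
    by simp
  have 1: "(\<forall>i\<in>S v. i < Suc k \<longrightarrow> (\<xi>(k := b)) i = val v i) \<longleftrightarrow>
      b = val v k \<and> (\<forall>i\<in>S v. i < k \<longrightarrow> \<xi> i = val v i)"
    using assms by (auto simp: less_Suc_eq)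
  show ?thesis unfolding survival_def 1 c power_Suc by auto
qed

text \<open>By disjointness coin \<open>k\<close> enters at most one factor. If \<open>s\<close> is
  the survival probability there, that factor becomes \<open>1 - 2 * s\<close> for one outcome and
  \<open>1\<close> for the other, with average \<open>1 - s\<close>.\<close>

lemma prod_survival_average:
  fixes S :: "'a \<Rightarrow> nat set" and val :: "'a \<Rightarrow> nat \<Rightarrow> bool" and G :: "'a set"
  assumes "finite G" "\<And>v. v \<in> G \<Longrightarrow> finite (S v)"
    and disj: "\<And>v w. v \<in> G \<Longrightarrow> w \<in> G \<Longrightarrow> v \<noteq> w \<Longrightarrow> S v \<inter> S w = {}"
  defines "P \<equiv> \<lambda>k \<xi>. \<Prod>v\<in>G. (1 - survival S val k \<xi> v)"
  shows "P (Suc k) (\<xi>(k := True)) + P (Suc k) (\<xi>(k := False)) = 2 * P k \<xi>"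
proof (cases "\<exists>v\<in>G. k \<in> S v")
  case False
  then show ?thesis by (simp add: P_def survival_upd_notin)
next
  case True
  then obtain v where v: "v \<in> G" "k \<in> S v" by auto
  define R where "R = (\<Prod>w\<in>G - {v}. (1 - survival S val k \<xi> w))"
  have "k \<notin> S w" if "w \<in> G - {v}" for w using disj[of v w] v that by auto
  then have 1: "P (Suc k) (\<xi>(k := b)) = (1 - survival S val (Suc k) (\<xi>(k := b)) v) * R" for b
    unfolding P_def R_def using v assms by (simp add: prod.remove survival_upd_notin)
  have 2: "P k \<xi> = (1 - survival S val k \<xi> v) * R"
    unfolding P_def R_def using v assms by (simp add: prod.remove)
  show ?thesis
    unfolding 1 2 using v(2) assms(2)[OF v(1)]
    by (cases "val v k") (simp_all add: survival_upd_in algebra_simps)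
qed

text \<open>The sum over \<open>j\<close> is the expected number of families \<open>G j\<close>
  without a survivor. Fixing coins one at a time can keep this conditional expectation below 1. A
  family depends on finitely many coins, so one without a survivor would eventually contribute a
  full 1.\<close>

lemma exists_surviving_assignment:
  fixes S :: "'a \<Rightarrow> nat set" and val :: "'a \<Rightarrow> nat \<Rightarrow> bool" and G :: "nat \<Rightarrow> 'a set"
  assumes finG: "\<And>j. finite (G j)" and finS: "\<And>j v. v \<in> G j \<Longrightarrow> finite (S v)"
    and disj: "\<And>j v w. v \<in> G j \<Longrightarrow> w \<in> G j \<Longrightarrow> v \<noteq> w \<Longrightarrow> S v \<inter> S w = {}"
    and summ: "summable (\<lambda>j. \<Prod>v\<in>G j. (1 - (1/2::real) ^ card (S v)))"
    and less1: "(\<Sum>j. \<Prod>v\<in>G j. (1 - (1/2::real) ^ card (S v))) < 1"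
  shows "\<exists>\<xi>. \<forall>j. \<exists>v\<in>G j. \<forall>i\<in>S v. \<xi> i = val v i"
proof -
  \<comment> \<open>Given the coins below \<open>k\<close>, this is the probability that nothing in
    \<open>G j\<close> survives; the product form reflects independence.\<close>
  define P where "P = (\<lambda>k \<xi> j. \<Prod>v\<in>G j. (1 - survival S val k \<xi> v))"
  have avg: "P (Suc k) (\<xi>(k := True)) j + P (Suc k) (\<xi>(k := False)) j = 2 * P k \<xi> j" for k \<xi> j
    unfolding P_def using finG finS disj by (intro prod_survival_average) blast+
  have P0: "0 \<le> P k \<xi> j" for k \<xi> j
    unfolding P_def by (intro prod_nonneg) (simp add: survival_le_1)
  have le2: "P (Suc k) (\<xi>(k := b)) j \<le> 2 * P k \<xi> j" for k \<xi> j b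
    using avg[of k \<xi> j] P0[of "Suc k" "\<xi>(k := True)" j] P0[of "Suc k" "\<xi>(k := False)" j]
    by (cases b) simp_all
  define \<Phi> where "\<Phi> = (\<lambda>k \<xi>. \<Sum>j. P k \<xi> j)"
  define good where "good = (\<lambda>k \<xi>. summable (P k \<xi>) \<and> \<Phi> k \<xi> < 1)"
  have step: "\<exists>b. good (Suc k) (\<xi>(k := b))" if "good k \<xi>" for k \<xi>
  proof -
    have s: "summable (P k \<xi>)" and l: "\<Phi> k \<xi> < 1" using that by (auto simp: good_def)
    \<comment> \<open>A single coin at most doubles each term, so summability persists.\<close>
    have s': "summable (P (Suc k) (\<xi>(k := b)))" for b
      by (rule summable_comparison_test'[OF summable_mult[OF s, of 2], of 0])
        (use le2 P0 in auto)
    have "\<Phi> (Suc k) (\<xi>(k := True)) + \<Phi> (Suc k) (\<xi>(k := False)) = 2 * \<Phi> k \<xi>"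
      unfolding \<Phi>_def using s s' by (simp add: suminf_add avg suminf_mult)
    then have "\<Phi> (Suc k) (\<xi>(k := True)) < 1 \<or> \<Phi> (Suc k) (\<xi>(k := False)) < 1"
      using l by linarith
    then show ?thesis using s' by (auto simp: good_def)
  qed
  define W where "W = rec_nat (\<lambda>_. False) (\<lambda>k \<xi>. \<xi>(k := (SOME b. good (Suc k) (\<xi>(k := b)))))"
  have W_Suc: "W (Suc k) = (W k)(k := (SOME b. good (Suc k) ((W k)(k := b))))" for k
    by (simp add: W_def)
  have W_good: "good k (W k)" for k
  proof (induction k)
    case 0
    have "P 0 (W 0) = (\<lambda>j. \<Prod>v\<in>G j. (1 - (1/2::real) ^ card (S v)))"
      by (simp add: P_def survival_def)
    then show ?case using summ less1 by (simp add: good_def \<Phi>_def)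
  next
    case (Suc k)
    then show ?case unfolding W_Suc by (rule someI_ex[OF step])
  qed
  define \<xi> where "\<xi> = (\<lambda>i. W (Suc i) i)"
  have W_stable: "W k i = \<xi> i" if "i < k" for k i
    using that
  proof (induction k)
    case (Suc k)
    then show ?case by (cases "i = k") (auto simp: \<xi>_def W_Suc)
  qed simp
  have "\<exists>v\<in>G j. \<forall>i\<in>S v. \<xi> i = val v i" for j
  proof (rule ccontr)
    assume dead: "\<not> ?thesis"
    \<comment> \<open>Beyond some stage \<open>k\<close> all coins relevant to \<open>G j\<close>
      are fixed, so each survival probability is 0 or 1.\<close>
    have "finite (\<Union>v\<in>G j. S v)" using finG finS by blast
    then obtain k where k: "i < k" if "i \<in> S v" "v \<in> G j" for i v
      by (metis UN_I finite_nat_set_iff_bounded)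
    have "survival S val k (W k) v = 0" if "v \<in> G j" for v
    proof -
      have "\<not> (\<forall>i\<in>S v. i < k \<longrightarrow> W k i = val v i)"
        using dead that k W_stable by metis
      then show ?thesis by (simp only: survival_def if_False)
    qed
    then have "P k (W k) j = 1" by (simp add: P_def)
    moreover have "P k (W k) j \<le> \<Phi> k (W k)"
      unfolding \<Phi>_def using W_good[of k] P0 sum_le_suminf[of "P k (W k)" "{j}"]
      by (simp add: good_def)
    ultimately show False using W_good[of k] by (simp add: good_def)
  qed
  then show ?thesis by blast
qed

section \<open>Integers in short intervals without small square divisors\<close>

lemma sum_inverse_squares_le: "(\<Sum>d=2..y. 1 / (real d)\<^sup>2) \<le> 3/4"
proof (cases "y < 2")
  case False
  then have "2 \<le> y" by simp
  \<comment> \<open>The term \<open>- 1 / real y\<close> makes the induction telescope; equality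
    holds at \<open>y = 2\<close>.\<close>
  then have "(\<Sum>d=2..y. 1 / (real d)\<^sup>2) \<le> 3/4 - 1 / real y"
  proof (induction y rule: dec_induct)
    case (step n)
    have "1 / (real (Suc n))\<^sup>2 \<le> 1 / real n - 1 / real (Suc n)"
      using step(1) by (simp add: divide_simps) (simp add: algebra_simps power2_eq_square)
    then show ?case using step by simp
  qed simp
  also have "\<dots> \<le> 3/4" by simp
  finally show ?thesis .
qed simp

lemma card_multiples_le:
  assumes "m > 0"
  shows "real (card {n \<in> {t<..t+h}. m dvd n}) \<le> real h / real m + 1"
proof -
  have "{n \<in> {t<..t+h}. m dvd n} \<subseteq> (*) m ` {t div m<..(t+h) div m}"
  proof
    fix n assume n: "n \<in> {n \<in> {t<..t+h}. m dvd n}"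
    then obtain q where q: "n = m * q" by auto
    have "t div m < q" "q \<le> (t + h) div m"
      using n q assms by (auto simp: div_less_iff_less_mult less_eq_div_iff_mult_less_eq mult.commute)
    then show "n \<in> (*) m ` {t div m<..(t+h) div m}" using q by auto
  qed
  then have "card {n \<in> {t<..t+h}. m dvd n} \<le> card {t div m<..(t+h) div m}"
    using surj_card_le by blast
  also have "\<dots> = (t+h) div m - t div m" by simp
  finally have "real (card {n \<in> {t<..t+h}. m dvd n}) \<le> real ((t+h) div m) - real (t div m)"
    by (simp add: div_le_mono of_nat_diff flip: of_nat_diff)
  also have "\<dots> \<le> real (t+h) / real m - (real t / real m - 1)"
  proof (intro diff_mono)
    show "real ((t+h) div m) \<le> real (t+h) / real m" by (rule of_nat_div_le_of_nat)
    have "t < m + m * (t div m)" using assms by (rule dividend_less_times_div)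
    then have "real t < real m + real m * real (t div m)" by (metis of_nat_add of_nat_less_iff of_nat_mult)
    then show "real t / real m - 1 \<le> real (t div m)" using assms by (simp add: field_simps)
  qed
  also have "\<dots> = real h / real m + 1" by (simp add: add_divide_distrib)
  finally show ?thesis .
qed

definition square_rough :: "nat \<Rightarrow> nat \<Rightarrow> bool" where
  "square_rough y n \<longleftrightarrow> (\<forall>d. 2 \<le> d \<and> d \<le> y \<longrightarrow> \<not> d\<^sup>2 dvd n)"

text \<open>Union bound over \<open>d\<close>: the main terms \<open>h / d^2\<close> remove at most
  \<open>3/4 * h\<close>, and the rounding errors, one for each \<open>d\<close> up to
  \<open>h div 8\<close>, at most another \<open>h / 8\<close>.\<close>

lemma card_square_rough_ge:
  "real h / 8 \<le> real (card {n \<in> {t<..t+h}. square_rough (h div 8) n})"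
proof -
  define A where "A = {n \<in> {t<..t+h}. square_rough (h div 8) n}"
  define B where "B = (\<Union>d\<in>{2..h div 8}. {n \<in> {t<..t+h}. d\<^sup>2 dvd n})"
  have "{t<..t+h} \<subseteq> A \<union> B" by (auto simp: A_def B_def square_rough_def)
  moreover have "finite (A \<union> B)" by (auto simp: A_def B_def)
  ultimately have "h \<le> card (A \<union> B)" using card_mono[of "A \<union> B" "{t<..t+h}"] by simp
  also have "\<dots> \<le> card A + card B" by (rule card_Un_le)
  finally have 1: "real h \<le> real (card A) + real (card B)" by linarith
  have "real (card B) \<le> real (\<Sum>d=2..h div 8. card {n \<in> {t<..t+h}. d\<^sup>2 dvd n})"
    unfolding B_def of_nat_le_iff by (intro card_UN_le) simp
  also have "\<dots> \<le> (\<Sum>d=2..h div 8. real h / real (d\<^sup>2) + 1)"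
    unfolding of_nat_sum by (intro sum_mono card_multiples_le) auto
  also have "\<dots> = real h * (\<Sum>d=2..h div 8. 1 / (real d)\<^sup>2) + real (Suc (h div 8) - 2)"
    by (simp add: sum.distrib sum_distrib_left)
  also have "\<dots> \<le> real h * (3/4) + real h / 8"
  proof (intro add_mono mult_left_mono sum_inverse_squares_le)
    have "real (Suc (h div 8) - 2) \<le> real (h div 8)" by simp
    also have "\<dots> \<le> real h / 8" using of_nat_div_le_of_nat[of h 8, where 'a = real] by simp
    finally show "real (Suc (h div 8) - 2) \<le> real h / 8" .
  qed simp
  finally show ?thesis using 1 unfolding A_def[symmetric] by simp
qed

section \<open>Counting divisors of the form \<open>a ^ 3 * b ^ 2\<close>\<close>

text \<open>The pairs parametrize the ways to write \<open>n = c * a ^ 3 * b ^ 2\<close>, hence the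
  possible partners in a linked pair.\<close>

definition cube_square_divisors :: "nat \<Rightarrow> (nat \<times> nat) set" where
  "cube_square_divisors n = {(a, b). a ^ 3 * b\<^sup>2 dvd n}"

lemma finite_cube_square_divisors:
  assumes "n > 0"
  shows "finite (cube_square_divisors n)"
proof (rule finite_subset)
  show "cube_square_divisors n \<subseteq> {..n} \<times> {..n}"
  proof (clarsimp simp: cube_square_divisors_def)
    fix a b assume "a ^ 3 * b\<^sup>2 dvd n"
    then have "a dvd n" "b dvd n"
      by (auto intro: dvd_trans[rotated] simp: power3_eq_cube power2_eq_square)
    then show "a \<le> n \<and> b \<le> n" using assms by (auto intro: dvd_imp_le)
  qed
qed simp

text \<open>Passing from \<open>n\<close> to \<open>n / p^2\<close> with \<open>p \<ge> y\<close>
  lowers the exponent of \<open>y\<close> by 2 and divides the count by at most 3. Once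
  \<open>n < y^2\<close>, no prime square divides \<open>n\<close> and only the pair
  \<open>(1, 1)\<close> remains.\<close>

lemma card_cube_square_divisors_le:
  assumes "n > 0" "\<And>p. prime p \<Longrightarrow> p\<^sup>2 dvd n \<Longrightarrow> y \<le> p" "n < y ^ (2 * k + 2)"
  shows "card (cube_square_divisors n) \<le> 3 ^ k"
  using assms
proof (induction k arbitrary: n)
  have "cube_square_divisors n \<subseteq> {(1, 1)}" if "n > 0" "\<And>p. prime p \<Longrightarrow> \<not> p\<^sup>2 dvd n" for n
  proof (clarsimp simp: cube_square_divisors_def)
    fix a b assume ab: "a ^ 3 * b\<^sup>2 dvd n"
    have "\<not> p dvd a" "\<not> p dvd b" if "prime p" for p
    proof -
      have np: "\<not> p\<^sup>2 dvd n" using that \<open>\<And>p. prime p \<Longrightarrow> \<not> p\<^sup>2 dvd n\<close> by simp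
      have "a\<^sup>2 dvd n" using dvd_trans[OF _ ab, of "a\<^sup>2"] by (simp add: power3_eq_cube power2_eq_square)
      then show "\<not> p dvd a" using np dvd_trans[of "p\<^sup>2" "a\<^sup>2" n] dvd_power_same[of p a 2] by blast
      have "b\<^sup>2 dvd n" using dvd_trans[OF _ ab, of "b\<^sup>2"] by simp
      then show "\<not> p dvd b" using np dvd_trans[of "p\<^sup>2" "b\<^sup>2" n] dvd_power_same[of p b 2] by blast
    qed
    then show "a = Suc 0 \<and> b = Suc 0" using prime_factor_nat[of a] prime_factor_nat[of b] by auto
  qed
  then have base: "card (cube_square_divisors n) \<le> 1" if "n > 0" "\<And>p. prime p \<Longrightarrow> \<not> p\<^sup>2 dvd n" for n
    using card_mono[of "{(1,1)}" "cube_square_divisors n"] that by simp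
  {
    case 0
    have "\<not> p\<^sup>2 dvd n" if "prime p" for p
    proof
      assume p: "p\<^sup>2 dvd n"
      then have "y\<^sup>2 \<le> p\<^sup>2" using 0 that by (simp add: power_mono)
      also have "\<dots> \<le> n" using p 0 by (simp add: dvd_imp_le)
      finally show False using 0 by (simp add: power2_eq_square)
    qed
    then show ?case using base[of n] 0 by simp
  next
    case (Suc k)
    show ?case
    proof (cases "\<exists>p. prime p \<and> p\<^sup>2 dvd n")
      case False
      then have "card (cube_square_divisors n) \<le> 1" using base Suc.prems by blast
      then show ?thesis using one_le_power[of "3::nat" "Suc k"] by linarith
    next
      case True
      then obtain p where p: "prime p" "p\<^sup>2 dvd n" by blast
      then obtain m where m: "n = p\<^sup>2 * m" by auto
      have m0: "m > 0" and p0: "p > 0" using m Suc.prems p by (auto intro: Nat.gr0I)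
      have yp: "y \<le> p" using Suc.prems p by blast
      have "p\<^sup>2 * m < y ^ (2 * Suc k + 2)" using Suc.prems m by simp
      also have "\<dots> = y\<^sup>2 * y ^ (2 * k + 2)" by (simp add: power2_eq_square)
      also have "\<dots> \<le> p\<^sup>2 * y ^ (2 * k + 2)" using yp by (simp add: power_mono)
      finally have "m < y ^ (2 * k + 2)" using p0 by simp
      moreover have "y \<le> q" if "prime q" "q\<^sup>2 dvd m" for q using Suc.prems m that by simp
      ultimately have IH: "card (cube_square_divisors m) \<le> 3 ^ k" using Suc.IH m0 by blast
      let ?D = "cube_square_divisors m"
      \<comment> \<open>Dividing \<open>n\<close> by \<open>p\<^sup>2\<close> at most cuts the number of pairs by a factor of three:
        drop \<open>p\<close> from \<open>b\<close>, or from \<open>a\<close>, or from neither.\<close>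
      have "(a, b) \<in> (\<lambda>(a, b). (p * a, b)) ` ?D"
        if ab: "(a, b) \<in> cube_square_divisors n" "(a, b) \<notin> (\<lambda>(a, b). (a, p * b)) ` ?D" "(a, b) \<notin> ?D"
        for a b
      proof -
        have d: "a ^ 3 * b\<^sup>2 dvd p\<^sup>2 * m" using ab m by (simp add: cube_square_divisors_def)
        have nb: "\<not> p dvd b"
        proof
          assume "p dvd b"
          then obtain b' where b': "b = p * b'" by auto
          have "p\<^sup>2 * (a ^ 3 * b'\<^sup>2) dvd p\<^sup>2 * m" using d b' by (simp add: power_mult_distrib mult_ac)
          then have "a ^ 3 * b'\<^sup>2 dvd m" using p0 by simp
          then show False using ab b' by (auto simp: cube_square_divisors_def)
        qed
        have "p dvd a"
        proof (rule ccontr)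
          assume "\<not> p dvd a"
          then have "coprime (a ^ 3 * b\<^sup>2) (p\<^sup>2)"
            using p nb prime_imp_coprime[of p a] prime_imp_coprime[of p b] by (simp add: coprime_commute)
          then have "a ^ 3 * b\<^sup>2 dvd m" using d by (simp add: coprime_dvd_mult_right_iff)
          then show False using ab by (simp add: cube_square_divisors_def)
        qed
        then obtain a' where a': "a = p * a'" by auto
        \<comment> \<open>The cube supplies one more factor \<open>p\<close> than was cancelled; it
          is discarded below.\<close>
        have "p\<^sup>2 * (p * (a' ^ 3 * b\<^sup>2)) dvd p\<^sup>2 * m"
          using d a' by (simp add: power_mult_distrib mult_ac power2_eq_square power3_eq_cube)
        then have "p * (a' ^ 3 * b\<^sup>2) dvd m" using p0 by simp
        then have "a' ^ 3 * b\<^sup>2 dvd m" by (rule dvd_mult_right)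
        then show ?thesis using a' by (force simp: cube_square_divisors_def)
      qed
      then have "cube_square_divisors n \<subseteq> ?D \<union> (\<lambda>(a, b). (p * a, b)) ` ?D \<union> (\<lambda>(a, b). (a, p * b)) ` ?D"
        by (intro subrelI) blast
      moreover have fin: "finite ?D" using finite_cube_square_divisors m0 by blast
      ultimately have "card (cube_square_divisors n) \<le>
          card (?D \<union> (\<lambda>(a, b). (p * a, b)) ` ?D \<union> (\<lambda>(a, b). (a, p * b)) ` ?D)"
        by (intro card_mono) auto
      also have "\<dots> \<le> card ?D + card ((\<lambda>(a, b). (p * a, b)) ` ?D) + card ((\<lambda>(a, b). (a, p * b)) ` ?D)"
        using card_Un_le[of ?D "(\<lambda>(a, b). (p * a, b)) ` ?D"]
          card_Un_le[of "?D \<union> (\<lambda>(a, b). (p * a, b)) ` ?D" "(\<lambda>(a, b). (a, p * b)) ` ?D"] by linarith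
      also have "\<dots> \<le> card ?D + card ?D + card ?D"
        using fin by (intro add_mono card_image_le) auto
      also have "\<dots> \<le> 3 ^ Suc k" using IH by simp
      finally show ?thesis .
    qed
  }
qed

section \<open>Asymptotics of the interval length\<close>

text \<open>Turns \<open>3 ^ k\<close> into a power of \<open>ln t\<close> with explicit exponent;
  the bound comes from six terms of the exponential series at \<open>11/10\<close>.\<close>

lemma ln_3_le: "ln 3 \<le> (11/10 :: real)"
proof -
  have "(3::real) \<le> (\<Sum>n<6. (11/10) ^ n /\<^sub>R fact n)"
    by (simp add: lessThan_nat_numeral fact_numeral eval_nat_numeral field_simps)
  also have "\<dots> \<le> exp (11/10)"
    unfolding exp_def by (intro sum_le_suminf summable_exp_generic) auto
  finally show ?thesis by (metis exp_gt_zero ln_exp ln_mono zero_less_numeral)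
qed

text \<open>The constant 5/9 lies strictly between \<open>ln 3 / 2\<close> and \<open>5/6 * ln 2\<close>.\<close>
definition gap :: "nat \<Rightarrow> nat" where
  "gap t = nat \<lfloor>exp (5/9 * ln (real t) / ln (ln (real t)))\<rfloor>"

text \<open>With \<open>y = gap t div 8\<close>, the first condition keeps linked
  \<open>y\<close>-rough integers out of a common interval. The number \<open>k\<close> bounds the
  prime squares to be stripped, and the last inequality pushes the failure probability down to
  \<open>t ^ (-2)\<close>.\<close>

lemma eventually_gap:
  "\<forall>\<^sub>F t in sequentially. gap t \<le> (gap t div 8)\<^sup>2 \<and>
     (\<exists>k. t + gap t < (gap t div 8) ^ (2 * k + 2) \<and> 2 * ln (real t) \<le> real (gap t) / 8 * (1/2) ^ (3 ^ k))"
proof -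
  define H where "H = (\<lambda>L::real. exp (5/9 * L / ln L))"
  \<comment> \<open>Here \<open>554/1000\<close> is just below \<open>5/9\<close>, absorbing the
    loss from dividing by 8 and rounding.\<close>
  have "\<forall>\<^sub>F L in at_top. 554/1000 * L / ln L \<le> ln (H L / 8 - 2)"
    unfolding H_def by real_asymp
  \<comment> \<open>The quotient of \<open>11/20\<close> by \<open>554/1000\<close> is below
    \<open>995/1000\<close>. As the latter is less than 1, \<open>3 ^ k\<close> stays below a power
    of \<open>L\<close> that is negligible against \<open>ln (H L)\<close>, which has order
    \<open>L / ln L\<close>.\<close>
  moreover have "\<forall>\<^sub>F L::real in at_top. 11/20 * (L + 1) / (554/1000 * L / ln L) \<le> 995/1000 * ln L"
    by real_asymp
  moreover have "\<forall>\<^sub>F L::real in at_top. 2 * L \<le> (H L - 1) / 8 * exp (- exp (995/1000 * ln L))"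
    unfolding H_def by real_asymp
  moreover have "\<forall>\<^sub>F L::real in at_top. 1000 \<le> H L"
    unfolding H_def by real_asymp
  moreover have "\<forall>\<^sub>F L::real in at_top. H L \<le> exp L"
    unfolding H_def by real_asymp
  moreover have "\<forall>\<^sub>F L::real in at_top. 2 \<le> L"
    by (rule eventually_ge_at_top)
  ultimately have "\<forall>\<^sub>F L in at_top. 554/1000 * L / ln L \<le> ln (H L / 8 - 2) \<and>
      11/20 * (L + 1) / (554/1000 * L / ln L) \<le> 995/1000 * ln L \<and>
      2 * L \<le> (H L - 1) / 8 * exp (- exp (995/1000 * ln L)) \<and>
      1000 \<le> H L \<and> H L \<le> exp L \<and> 2 \<le> L"
    by eventually_elim simp
  moreover have "filterlim (\<lambda>t. ln (real t)) at_top sequentially"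
    by real_asymp
  ultimately have "\<forall>\<^sub>F t in sequentially. 554/1000 * ln (real t) / ln (ln (real t)) \<le> ln (H (ln (real t)) / 8 - 2) \<and>
      11/20 * (ln (real t) + 1) / (554/1000 * ln (real t) / ln (ln (real t))) \<le> 995/1000 * ln (ln (real t)) \<and>
      2 * ln (real t) \<le> (H (ln (real t)) - 1) / 8 * exp (- exp (995/1000 * ln (ln (real t)))) \<and>
      1000 \<le> H (ln (real t)) \<and> H (ln (real t)) \<le> exp (ln (real t)) \<and> 2 \<le> ln (real t)"
    by (rule eventually_compose_filterlim)
  then show ?thesis using eventually_gt_at_top[of 0]
  proof eventually_elim
    case (elim t)
    define L where "L = ln (real t)"
    define h where "h = gap t"
    define y where "y = h div 8"
    define B where "B = 554/1000 * L / ln L"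
    \<comment> \<open>Chosen so that \<open>y ^ (2 * k + 2)\<close> exceeds
      \<open>exp (L + 1)\<close>, that is \<open>e * t\<close>, which bounds
      \<open>t + h\<close>.\<close>
    define k where "k = nat \<lfloor>(L + 1) / (2 * ln (real y))\<rfloor>"
    have B: "B \<le> ln (H L / 8 - 2)" "11/20 * (L + 1) / B \<le> 995/1000 * ln L"
      and fin: "2 * L \<le> (H L - 1) / 8 * exp (- exp (995/1000 * ln L))"
      and H1000: "1000 \<le> H L" and Ht: "H L \<le> real t" and L2: "2 \<le> L" and t0: "0 < t"
      using elim by (auto simp: L_def B_def)
    have h: "H L - 1 \<le> real h" "real h \<le> H L"
      using H1000 unfolding h_def gap_def L_def H_def by linarith+
    have "h < 8 * y + 8" unfolding y_def by linarith
    then have y: "H L / 8 - 2 \<le> real y" using h by linarith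
    then have "real y \<ge> 100" using H1000 by linarith
    then have y100: "y \<ge> 100" by simp
    have Bpos: "B > 0" using L2 by (simp add: B_def)
    have By: "B \<le> ln (real y)" 
    proof (rule order_trans[OF B(1)])
      show "ln (H L / 8 - 2) \<le> ln (real y)" using y H1000 by (subst ln_le_cancel_iff) auto
    qed
    have hy: "h \<le> y\<^sup>2"
    proof -
      have "h \<le> 8 * y + 8" using \<open>h < 8 * y + 8\<close> by simp
      also have "\<dots> \<le> 100 * y" using y100 by simp
      also have "\<dots> \<le> y * y" using y100 by simp
      finally show ?thesis by (simp add: power2_eq_square)
    qed
    have k1: "real k \<le> (L + 1) / (2 * ln (real y))" and k2: "(L + 1) / (2 * ln (real y)) < real k + 1"
      using By Bpos L2 unfolding k_def by (auto simp: of_nat_nat)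
    have "exp (L + 1) < real (y ^ (2 * k + 2))"
    proof -
      have "L + 1 < (real k + 1) * (2 * ln (real y))"
        using k2 By Bpos by (simp add: divide_less_eq)
      also have "\<dots> = ln (real (y ^ (2 * k + 2)))"
        unfolding of_nat_power using y100 by (subst ln_realpow) (auto simp: algebra_simps)
      finally show ?thesis using y100 by (metis exp_less_cancel_iff exp_ln of_nat_0_less_iff zero_less_power less_le_trans zero_less_numeral)
    qed
    moreover have "real (t + h) \<le> exp (L + 1)"
    proof -
      have "real (t + h) \<le> 2 * real t" using h(2) Ht by simp
      also have "\<dots> \<le> exp 1 * real t" using exp_ge_add_one_self[of 1] by (intro mult_right_mono) auto
      also have "\<dots> = exp (L + 1)" using t0 by (simp add: L_def exp_add)
      finally show ?thesis .
    qed
    ultimately have lt: "t + h < y ^ (2 * k + 2)" by (metis le_less_trans of_nat_less_iff)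
    have "real (3 ^ k) \<le> exp (995/1000 * ln L)"
    proof -
      have "real (3 ^ k) = exp (real k * ln 3)" by (simp add: exp_of_nat_mult)
      also have "real k * ln 3 \<le> (L + 1) / (2 * ln (real y)) * (11/10)"
        using k1 ln_3_le by (intro mult_mono) auto
      also have "\<dots> = 11/20 * (L + 1) / ln (real y)" by simp
      also have "\<dots> \<le> 11/20 * (L + 1) / B" using By Bpos L2 by (intro divide_left_mono) auto
      also have "\<dots> \<le> 995/1000 * ln L" by (rule B)
      finally show ?thesis by simp
    qed
    moreover have "real (3 ^ k) * ln 2 \<le> real (3 ^ k) * 1"
      using ln_2_less_1 by (intro mult_left_mono) auto
    ultimately have "real (3 ^ k) * ln 2 \<le> exp (995/1000 * ln L)" by linarith
    then have "exp (- exp (995/1000 * ln L)) \<le> exp (- (real (3 ^ k) * ln 2))" by simp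
    also have "\<dots> = (1/2) ^ (3 ^ k)"
      by (simp add: exp_minus exp_of_nat_mult power_one_over inverse_eq_divide del: of_nat_power)
    finally have "(H L - 1) / 8 * exp (- exp (995/1000 * ln L)) \<le> real h / 8 * (1/2) ^ (3 ^ k)"
      using h(1) H1000 by (intro mult_mono) auto
    then have "2 * L \<le> real h / 8 * (1/2) ^ (3 ^ k)" using fin by linarith
    then show ?case using hy lt unfolding y_def h_def L_def by blast
  qed
qed

section \<open>Linked pairs and geometric progressions\<close>

text \<open>These are the two middle terms of
  \<open>c * a ^ 5, c * a ^ 4 * b, ..., c * b ^ 5\<close>; both \<open>a^2\<close> and
  \<open>b^2\<close> divide each of them.\<close>

definition linked :: "nat \<Rightarrow> nat \<Rightarrow> bool" where
  "linked n m \<longleftrightarrow> (\<exists>a b c. a \<noteq> b \<and> n = c * a ^ 3 * b\<^sup>2 \<and> m = c * a\<^sup>2 * b ^ 3)"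

lemma linked_sym: "linked n m \<Longrightarrow> linked m n"
  unfolding linked_def by (metis mult.assoc mult.commute)

lemma linked_pos: "linked n m \<Longrightarrow> 0 < n \<Longrightarrow> 0 < m"
  by (auto simp: linked_def)

lemma linked_neq:
  assumes "linked n m" "0 < n"
  shows "n \<noteq> m"
  using assms by (auto simp: linked_def power2_eq_square power3_eq_cube)

text \<open>For fixed \<open>n > 0\<close> the pair \<open>(a, b)\<close> determines
  \<open>c\<close>, and with it the partner \<open>m\<close>.\<close>

lemma linked_subset_image:
  assumes "0 < n"
  shows "{m. linked n m} \<subseteq> (\<lambda>(a, b). n div (a ^ 3 * b\<^sup>2) * (a\<^sup>2 * b ^ 3)) ` cube_square_divisors n"
proof
  fix m assume "m \<in> {m. linked n m}"
  then obtain a b c where abc: "n = c * (a ^ 3 * b\<^sup>2)" "m = c * (a\<^sup>2 * b ^ 3)"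
    by (auto simp: linked_def mult.assoc)
  then have "n div (a ^ 3 * b\<^sup>2) = c" using assms by simp
  then have "m = (\<lambda>(a, b). n div (a ^ 3 * b\<^sup>2) * (a\<^sup>2 * b ^ 3)) (a, b)"
    using abc by simp
  moreover have "(a, b) \<in> cube_square_divisors n"
    using abc by (simp add: cube_square_divisors_def)
  ultimately show "m \<in> (\<lambda>(a, b). n div (a ^ 3 * b\<^sup>2) * (a\<^sup>2 * b ^ 3)) ` cube_square_divisors n"
    by blast
qed

lemma finite_linked: "0 < n \<Longrightarrow> finite {m. linked n m}"
  using linked_subset_image finite_cube_square_divisors by (meson finite_imageI finite_subset)

lemma card_linked_le: "0 < n \<Longrightarrow> card {m. linked n m} \<le> card (cube_square_divisors n)"
  using linked_subset_image finite_cube_square_divisors by (meson surj_card_le)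

text \<open>For a ratio \<open>p / q\<close> in lowest terms, integrality of the sixth term forces
  \<open>q ^ 5\<close> to divide the first, so the terms with indices 2 and 3 form a linked
  pair.\<close>

lemma GP_free_6I:
  assumes unlinked: "\<And>n m. n \<in> S \<Longrightarrow> m \<in> S \<Longrightarrow> \<not> linked n m"
  shows "GP_free 6 S"
  unfolding GP_free_def
proof clarify
  fix r a
  assume gp: "geometric_progression 6 r a" and "r \<noteq> 1" and S: "\<forall>i<6. a i \<in> real ` S"
  have r: "r \<in> \<rat>" "r > 0" and step: "\<And>i. i \<in> {1..<6} \<Longrightarrow> a i = r * a (i - 1)"
    using gp by (auto simp: geometric_progression_def)
  obtain p q :: nat where pq: "q \<noteq> 0" "\<bar>r\<bar> = real p / real q" "coprime p q"
    using Rats_abs_nat_div_natE[OF r(1)] by blast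
  have r_eq: "r = real p / real q" using pq r by simp
  obtain s where s: "\<And>i. i < 6 \<Longrightarrow> s i \<in> S" "\<And>i. i < 6 \<Longrightarrow> a i = real (s i)"
    using S unfolding image_iff by metis
  have a: "a 1 = r * a 0" "a 2 = r * a 1" "a 3 = r * a 2" "a 4 = r * a 3" "a 5 = r * a 4"
    using step[of 1] step[of 2] step[of 3] step[of 4] step[of 5] by simp_all
  have "real (s 5) = r ^ 5 * real (s 0)"
    using a s(2)[of 0] s(2)[of 5] by (simp add: eval_nat_numeral)
  then have "real (s 5 * q ^ 5) = real (s 0 * p ^ 5)"
    using pq by (simp add: r_eq field_simps)
  then have eq: "s 5 * q ^ 5 = s 0 * p ^ 5" by (simp only: of_nat_eq_iff)
  have "q ^ 5 dvd s 0 * p ^ 5" by (simp flip: eq)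
  moreover have "coprime (q ^ 5) (p ^ 5)" using pq by (simp add: coprime_commute)
  ultimately have "q ^ 5 dvd s 0" by (simp add: coprime_dvd_mult_left_iff)
  then obtain c where c: "s 0 = c * q ^ 5" by (metis dvd_div_mult_self)
  have "r * (r * real (s 0)) = real (c * q ^ 3 * p\<^sup>2)"
    "r * (r * (r * real (s 0))) = real (c * q\<^sup>2 * p ^ 3)"
    using pq by (simp_all add: c r_eq eval_nat_numeral mult_ac)
  then have "a 2 = real (c * q ^ 3 * p\<^sup>2)" "a 3 = real (c * q\<^sup>2 * p ^ 3)"
    using a(1-3) s(2)[of 0] by simp_all
  then have "real (s 2) = real (c * q ^ 3 * p\<^sup>2)" "real (s 3) = real (c * q\<^sup>2 * p ^ 3)"
    by (simp_all add: s(2))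
  moreover have "q \<noteq> p" using \<open>r \<noteq> 1\<close> pq r_eq by auto
  ultimately have "linked (s 2) (s 3)" unfolding linked_def of_nat_eq_iff by blast
  then show False using unlinked s(1) by simp
qed

text \<open>The expression \<open>n + m - 2 * min n m\<close> is the distance of \<open>n\<close>
  and \<open>m\<close> in natural numbers. For \<open>a < b\<close> it equals
  \<open>c * a^2 * b^2 * (b - a)\<close>, hence is at least \<open>b^2\<close>, and roughness forces
  \<open>b > y\<close>.\<close>

lemma linked_far_apart:
  assumes "linked n m" "0 < n" "square_rough y n" "square_rough y m"
  shows "y\<^sup>2 < n + m - 2 * min n m"
proof -
  have *: "y\<^sup>2 < n + m - 2 * min n m"
    if ab: "a < b" "n = c * a ^ 3 * b\<^sup>2" "m = c * a\<^sup>2 * b ^ 3" and n: "0 < n" "square_rough y n"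
    for a b c n m
  proof -
    obtain d where d: "b = a + d" "0 < d" using ab(1) less_imp_add_positive by blast
    have pos: "0 < a" "0 < c" using ab n by (auto intro: Nat.gr0I)
    have "b\<^sup>2 dvd n" using ab by simp
    moreover have "2 \<le> b" using pos ab(1) by simp
    ultimately have "y < b" using n(2) unfolding square_rough_def by (meson not_le)
    then have "y\<^sup>2 < b\<^sup>2" by (simp add: power_strict_mono)
    also have "b\<^sup>2 * 1 \<le> b\<^sup>2 * (c * a\<^sup>2 * d)" using pos d by (intro mult_left_mono) auto
    finally have "y\<^sup>2 < b\<^sup>2 * (c * a\<^sup>2 * d)" by simp
    moreover have "m = n + b\<^sup>2 * (c * a\<^sup>2 * d)"
      using ab(2,3) by (simp add: d(1) power2_eq_square power3_eq_cube algebra_simps)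
    ultimately show ?thesis by simp
  qed
  obtain a b c where abc: "a \<noteq> b" "n = c * a ^ 3 * b\<^sup>2" "m = c * a\<^sup>2 * b ^ 3"
    using assms(1) by (auto simp: linked_def)
  then consider "a < b" | "b < a" by linarith
  then show ?thesis
  proof cases
    case 1
    then show ?thesis using *[of a b n c m] abc assms by blast
  next
    case 2
    have "0 < m" using linked_pos assms by blast
    moreover have "m = c * b ^ 3 * a\<^sup>2" "n = c * b\<^sup>2 * a ^ 3" using abc by simp_all
    ultimately have "y\<^sup>2 < m + n - 2 * min m n" using *[of b a m c n] 2 assms by blast
    then show ?thesis by (simp add: add.commute min.commute)
  qed
qed

section \<open>The random deletion and its derandomization\<close>

lemma prod_one_minus_le_exp:
  fixes x :: "'a \<Rightarrow> real"
  assumes "finite A" "\<And>v. v \<in> A \<Longrightarrow> \<delta> \<le> x v" "\<And>v. v \<in> A \<Longrightarrow> x v \<le> 1"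
  shows "(\<Prod>v\<in>A. (1 - x v)) \<le> exp (- (real (card A) * \<delta>))"
proof -
  have "(\<Prod>v\<in>A. (1 - x v)) \<le> (\<Prod>v\<in>A. exp (- \<delta>))"
  proof (intro prod_mono conjI)
    fix v assume "v \<in> A"
    then show "0 \<le> 1 - x v" "1 - x v \<le> exp (- \<delta>)"
      using assms(2,3)[of v] exp_ge_add_one_self[of "- \<delta>"] by linarith+
  qed
  also have "\<dots> = exp (- (real (card A) * \<delta>))" by (simp add: exp_of_nat_mult[symmetric])
  finally show ?thesis .
qed

lemma exists_unlinked_set:
  "\<exists>T X. T \<subseteq> {0<..} \<and> (\<forall>n\<in>T. \<forall>m\<in>T. \<not> linked n m) \<and> (\<forall>t\<ge>X. \<exists>n\<in>T. t < n \<and> n \<le> t + gap t)"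
proof -
  obtain X0 where X0: "gap t \<le> (gap t div 8)\<^sup>2"
      "\<exists>k. t + gap t < (gap t div 8) ^ (2 * k + 2) \<and> 2 * ln (real t) \<le> real (gap t) / 8 * (1/2) ^ (3 ^ k)"
    if "X0 \<le> t" for t
    using eventually_gap unfolding eventually_sequentially by blast
  have summ: "summable (\<lambda>t. inverse ((real t)\<^sup>2))"
    by (rule inverse_power_summable) simp
  \<comment> \<open>Intervals starting at \<open>t\<close> fail with probability at most
    \<open>t ^ (-2)\<close>, so from \<open>X1\<close> on the expected number of failures is below
    1.\<close>
  obtain X1 where X1: "norm (\<Sum>j. inverse ((real (j + t))\<^sup>2)) < 1" if "X1 \<le> t" for t
    using suminf_exist_split[OF zero_less_one summ] by blast
  obtain X where X: "X0 \<le> X" "X1 \<le> X" "0 < X"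
    using that[of "Suc (max X0 X1)"] by force
  define G where "G = (\<lambda>j. {n \<in> {j+X<..j+X + gap (j+X)}. square_rough (gap (j+X) div 8) n})"
  \<comment> \<open>Each linked pair owns one coin, indexed by its ordered encoding so that both
    members name the same coin. By \<open>val\<close>, the outcome \<open>True\<close> keeps the
    smaller member and \<open>False\<close> the larger.\<close>
  define S where "S = (\<lambda>n. (\<lambda>m. prod_encode (min n m, max n m)) ` {m. linked n m})"
  define val where "val = (\<lambda>n i. n = fst (prod_decode i))"
  have Gpos: "0 < n" if "n \<in> G j" for n j using that by (auto simp: G_def)
  have finG: "finite (G j)" for j by (simp add: G_def)
  have finS: "finite (S n)" if "n \<in> G j" for n j
    using finite_linked Gpos[OF that] by (simp add: S_def)
  have disj: "S v \<inter> S w = {}" if vw: "v \<in> G j" "w \<in> G j" "v \<noteq> w" for j v w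
  proof (rule ccontr)
    assume "S v \<inter> S w \<noteq> {}"
    then obtain i where "i \<in> S v" "i \<in> S w" by blast
    then obtain v' w' where l: "linked v v'" "linked w w'"
      and "i = prod_encode (min v v', max v v')" "i = prod_encode (min w w', max w w')"
      unfolding S_def by blast
    then have "min v v' = min w w'" "max v v' = max w w'" by (simp_all add: prod_encode_eq)
    \<comment> \<open>Distinct \<open>v\<close> and \<open>w\<close> can share a coin only as the
      two members of its pair, which their distance rules out.\<close>
    then have "v' = w" using vw(3) by (auto simp: min_def max_def split: if_splits)
    then have "(gap (j+X) div 8)\<^sup>2 < v + w - 2 * min v w"
      using linked_far_apart[of v w] l vw Gpos by (simp add: G_def)
    also have "\<dots> < gap (j+X)"
      using vw by (auto simp: G_def min_def)
    finally show False using X0(1)[of "j+X"] X(1) by simp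
  qed
  have term_le: "(\<Prod>v\<in>G j. (1 - (1/2::real) ^ card (S v))) \<le> inverse ((real (j+X))\<^sup>2)" for j
  proof -
    define t where "t = j + X"
    define h where "h = gap t"
    define y where "y = h div 8"
    have t: "X0 \<le> t" "0 < t" using X by (simp_all add: t_def)
    obtain k where k: "t + h < y ^ (2 * k + 2)" "2 * ln (real t) \<le> real h / 8 * (1/2) ^ (3 ^ k)"
      using X0(2)[OF t(1)] unfolding h_def y_def by blast
    have "card (S v) \<le> 3 ^ k" if v: "v \<in> G j" for v
    proof -
      have v': "0 < v" "v \<le> t + h" "square_rough y v"
        using v by (auto simp: G_def y_def h_def t_def)
      have "card (S v) \<le> card {m. linked v m}"
        unfolding S_def using finite_linked v' by (intro card_image_le) blast
      also have "\<dots> \<le> card (cube_square_divisors v)" using card_linked_le v' by blast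
      also have "\<dots> \<le> 3 ^ k"
      proof (rule card_cube_square_divisors_le)
        show "v < y ^ (2 * k + 2)" using v' k by linarith
        show "y \<le> p" if "prime p" "p\<^sup>2 dvd v" for p
          using that v'(3) prime_ge_2_nat unfolding square_rough_def by (meson nat_le_linear)
      qed (use v' in simp)
      finally show ?thesis .
    qed
    then have "(\<Prod>v\<in>G j. (1 - (1/2::real) ^ card (S v))) \<le> exp (- (real (card (G j)) * (1/2) ^ (3 ^ k)))"
      using finG by (intro prod_one_minus_le_exp) (auto intro: power_decreasing power_le_one)
    also have "\<dots> \<le> exp (- (2 * ln (real t)))"
    proof -
      have "real h / 8 * (1/2) ^ (3 ^ k) \<le> real (card (G j)) * (1/2) ^ (3 ^ k)"
        using card_square_rough_ge[of h t] by (intro mult_right_mono) (auto simp: G_def h_def t_def)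
      then show ?thesis using k(2) unfolding exp_le_cancel_iff neg_le_iff_le by linarith
    qed
    also have "\<dots> = inverse ((real t)\<^sup>2)"
      using t by (simp add: exp_minus exp_double)
    finally show ?thesis by (simp add: t_def)
  qed
  have nonneg: "0 \<le> (\<Prod>v\<in>G j. (1 - (1/2::real) ^ card (S v)))" for j
    by (rule prod_nonneg) (simp add: power_le_one)
  have summ': "summable (\<lambda>j. inverse ((real (j+X))\<^sup>2))"
    by (rule summable_ignore_initial_segment[OF summ])
  have sG: "summable (\<lambda>j. \<Prod>v\<in>G j. (1 - (1/2::real) ^ card (S v)))"
    by (rule summable_comparison_test'[OF summ', of 0]) (use term_le nonneg in auto)
  have less1: "(\<Sum>j. \<Prod>v\<in>G j. (1 - (1/2::real) ^ card (S v))) < 1"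
  proof -
    have "(\<Sum>j. \<Prod>v\<in>G j. (1 - (1/2::real) ^ card (S v))) \<le> (\<Sum>j. inverse ((real (j+X))\<^sup>2))"
      by (rule suminf_le[OF term_le sG summ'])
    also have "\<dots> < 1" using X1[OF X(2)] by simp
    finally show ?thesis .
  qed
  have "\<exists>\<xi>. \<forall>j. \<exists>v\<in>G j. \<forall>i\<in>S v. \<xi> i = val v i"
    using finG finS disj sG less1 by (rule exists_surviving_assignment)
  then obtain \<xi> where \<xi>: "\<And>j. \<exists>v\<in>G j. \<forall>i\<in>S v. \<xi> i = val v i"
    by blast
  define T where "T = {n. 0 < n \<and> (\<forall>i\<in>S n. \<xi> i = val n i)}"
  have "\<not> linked n m" if "n \<in> T" "m \<in> T" for n m
  proof
    assume l: "linked n m"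
    define i where "i = prod_encode (min n m, max n m)"
    have "i \<in> S n" using l by (auto simp: S_def i_def)
    moreover have "i \<in> S m" using linked_sym[OF l] by (auto simp: S_def i_def min.commute max.commute)
    ultimately have "val n i = val m i" using that by (auto simp: T_def)
    \<comment> \<open>The coin favours exactly one member, so agreeing values would identify the
      two.\<close>
    then have "n = m" by (auto simp: val_def i_def min_def split: if_splits)
    then show False using linked_neq[OF l] that by (simp add: T_def)
  qed
  moreover have "\<exists>n\<in>T. t < n \<and> n \<le> t + gap t" if "X \<le> t" for t
  proof -
    obtain n where n: "n \<in> G (t - X)" "\<forall>i\<in>S n. \<xi> i = val n i" using \<xi> by blast
    then have "n \<in> T" using Gpos by (simp add: T_def)
    then show ?thesis using n(1) that by (auto simp: G_def)
  qed
  ultimately show ?thesis by (intro exI[of _ T] exI[of _ X]) (auto simp: T_def)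
qed

section \<open>From the unlinked set to the sequence\<close>

lemma gap_le_exp:
  assumes "3 \<le> t" "\<epsilon> > 0"
  shows "real (gap t) \<le> exp ((5/6 * ln 2 + \<epsilon>) * (ln (real t) / ln (ln (real t))))"
proof -
  have "1 \<le> ln (real t)" using assms(1) exp_le by (subst ln_ge_iff) auto
  then have nonneg: "0 \<le> ln (real t) / ln (ln (real t))" by simp
  have "real (gap t) \<le> exp (5/9 * ln (real t) / ln (ln (real t)))"
    unfolding gap_def by simp
  also have "\<dots> = exp (5/9 * (ln (real t) / ln (ln (real t))))" by simp
  \<comment> \<open>Since \<open>ln 2 \<ge> 2/3\<close>, the product \<open>5/6 * ln 2\<close> is at
    least \<open>5/9\<close>.\<close>
  also have "\<dots> \<le> exp ((5/6 * ln 2 + \<epsilon>) * (ln (real t) / ln (ln (real t))))"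
    using nonneg assms(2) ln2_ge_two_thirds unfolding exp_le_cancel_iff by (intro mult_right_mono) auto
  finally show ?thesis .
qed

text \<open>The sum of ratios in \<open>C\<close> covers the finitely many early indices; the
  summand 2 makes all inequalities strict.\<close>

lemma eventually_le_imp_const_mult_less:
  fixes d g :: "nat \<Rightarrow> real"
  assumes d: "\<And>i. N < i \<Longrightarrow> d i \<le> g i" and g: "\<And>i. 0 < g i"
  shows "\<exists>C>0. \<forall>i. d i < C * g i"
proof -
  define C where "C = 2 + (\<Sum>i\<le>N. \<bar>d i\<bar> / g i)"
  have C2: "2 \<le> C" unfolding C_def using g by (simp add: sum_nonneg less_imp_le)
  have "d i < C * g i" for i
  proof (cases "N < i")
    case True
    have "2 * g i \<le> C * g i" using C2 g[of i] by (intro mult_right_mono) auto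
    then show ?thesis using d[OF True] g[of i] by linarith
  next
    case False
    then have "\<bar>d i\<bar> / g i \<le> (\<Sum>i\<le>N. \<bar>d i\<bar> / g i)"
      using g by (intro member_le_sum) (auto simp: less_imp_le)
    moreover have "d i / g i \<le> \<bar>d i\<bar> / g i" using g[of i] by (intro divide_right_mono) auto
    ultimately have "d i / g i < C" unfolding C_def by linarith
    then show ?thesis using g[of i] by (simp add: divide_less_eq)
  qed
  then show ?thesis using C2 by (intro exI[of _ C]) auto
qed

theorem theorem1:
  "\<exists>t :: nat \<Rightarrow> nat.
     strict_mono_on {1..} t \<and>
     (\<forall>i\<ge>1. t i > 0) \<and>
     GP_free 6 (t ` {1..}) \<and>
     (\<forall>\<epsilon>::real. \<epsilon> > 0 \<longrightarrow>
        (\<exists>C::real. C > 0 \<and>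
           (\<forall>i\<ge>1. real (t (i + 1)) - real (t i) <
              C * exp ((5 / 6 * ln 2 + \<epsilon>) *
                (if t i = 1 then 0 else ln (real (t i)) / ln (ln (real (t i))))))))"
proof -
  \<comment> \<open>The set and its gap bound do not involve \<open>\<epsilon>\<close>, so one
    sequence serves every \<open>\<epsilon>\<close>.\<close>
  obtain T X where T: "T \<subseteq> {0<..}" "\<And>n m. n \<in> T \<Longrightarrow> m \<in> T \<Longrightarrow> \<not> linked n m"
    and X: "\<And>t. X \<le> t \<Longrightarrow> \<exists>n\<in>T. t < n \<and> n \<le> t + gap t"
    using exists_unlinked_set by blast
  have inf: "infinite T"
    unfolding infinite_nat_iff_unbounded
  proof
    fix m show "\<exists>n>m. n \<in> T" using X[of "max X m"] by force
  qed
  \<comment> \<open>\<open>enumerate\<close> counts from 0, whereas the sequence is indexed from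
    1.\<close>
  define t where "t = (\<lambda>i. enumerate T (i - 1))"
  have tT: "t i \<in> T" for i unfolding t_def using inf by (rule enumerate_in_set)
  have mono: "strict_mono_on {1..} t"
    unfolding t_def by (intro strict_mono_onI enumerate_mono inf) auto
  have next_le: "t (i + 1) \<le> n" if "1 \<le> i" "n \<in> T" "t i < n" for i n
  proof -
    have "t (i + 1) = enumerate T (Suc (i - 1))" using that by (simp add: t_def)
    also have "\<dots> = (LEAST s. s \<in> T \<and> t i < s)" by (simp add: enumerate_Suc''[OF inf] t_def)
    also have "\<dots> \<le> n" using that by (intro Least_le) auto
    finally show ?thesis .
  qed
  have large: "max X 3 \<le> t i" if "max X 3 < i" for i
    using le_enumerate[OF inf, of "i - 1"] that unfolding t_def by linarith
  have "\<exists>C>0. \<forall>i\<ge>1. real (t (i + 1)) - real (t i) <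
      C * exp ((5 / 6 * ln 2 + \<epsilon>) * (if t i = 1 then 0 else ln (real (t i)) / ln (ln (real (t i)))))"
    if "\<epsilon> > 0" for \<epsilon> :: real
  proof -
    define g where "g = (\<lambda>i. exp ((5 / 6 * ln 2 + \<epsilon>) *
        (if t i = 1 then 0 else ln (real (t i)) / ln (ln (real (t i))))))"
    have "real (t (i + 1)) - real (t i) \<le> g i" if i: "max X 3 < i" for i
    proof -
      have t3: "X \<le> t i" "3 \<le> t i" using large[OF i] by simp_all
      obtain n where "n \<in> T" "t i < n" "n \<le> t i + gap (t i)" using X[OF t3(1)] by blast
      then have "t (i + 1) \<le> t i + gap (t i)" using next_le[of i n] i by simp
      then have "real (t (i + 1)) - real (t i) \<le> real (gap (t i))" by linarith
      also have "\<dots> \<le> g i" using gap_le_exp[OF t3(2) \<open>\<epsilon> > 0\<close>] t3(2) by (simp add: g_def)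
      finally show ?thesis .
    qed
    then obtain C where "C > 0" "\<forall>i. real (t (i + 1)) - real (t i) < C * g i"
      using eventually_le_imp_const_mult_less[of "max X 3" "\<lambda>i. real (t (i + 1)) - real (t i)" g]
      by (auto simp: g_def)
    then show ?thesis unfolding g_def by blast
  qed
  moreover have "GP_free 6 (t ` {1..})" using T(2) tT by (intro GP_free_6I) auto
  moreover have "\<forall>i\<ge>1. t i > 0" using T(1) tT by auto
  ultimately show ?thesis using mono by (intro exI[of _ t]) blast
qed

end
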